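(* Let $D$ be a defeasible theory and $S_D$ its compiled program. Let $\mathcal P$ be the set of predicates of $S_D$, let $\mathcal F$ be the set of predicates of $S_D$ of the forms $\mathtt{definitely\_q}$, $\mathtt{body}^\Delta_r$, $\mathtt{lambda\_q}$ and $\mathtt{body}^\lambda_r$, and let $\mathcal Q=\mathcal P\setminus\mathcal F$. Then (a) $\mathcal P$ is downward-closed with floor $\mathcal F$; (b) $\mathcal Q$ has a signing $s$ in which every predicate of the form $\mathtt{defeasibly\_q}$ is assigned $+1$; and (c) for every predicate $q$ of $D$, the predicate $\mathtt{defeasibly\_q}$ avoids negative unfoundedness with respect to $s$.
   Context: Defeasible theories. A literal is an atom $p(t_1,\dots,t_n)$ or its classical negation; ${\sim}q$ is the complementary literal. A defeasible theory $D=(F,R,>)$ consists of a finite set $F$ of variable-free literals (facts), a finite set $R$ of labelled rules $r$ with finite antecedent set $A(r)$, consequent $C(r)$ and kind strict ($\to$), defeasible ($\Rightarrow$) or defeater ($\leadsto$), and an acyclic superiority relation $>$ on labels. Compiled program. For a literal $q$ with predicate $p$, $\mathtt{q}$ denotes $\mathtt{p}$ if $q$ is positive and $\mathtt{not\_p}$ if negative; $\mathtt{{\sim}q}$ is the name of the complement; predicate names are formed by concatenation; rule labels are constants. $S_D$ consists exactly of: (i) for each fact $q(\vec a)$: unit clauses $\mathtt{definitely\_q}(\vec a)$, $\mathtt{lambda\_q}(\vec a)$, $\mathtt{defeasibly\_q}(\vec a)$; (ii) for each strict rule $r:q_1(\vec a_1),\dots,q_n(\vec a_n)\to q(\vec a)$: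 $\mathtt{definitely\_q}(\vec a)\,\text{:-}\,\mathtt{body}^\Delta_r(\vec a)$, $\mathtt{lambda\_q}(\vec a)\,\text{:-}\,\mathtt{body}^\Delta_r(\vec a)$, $\mathtt{defeasibly\_q}(\vec a)\,\text{:-}\,\mathtt{body}^\Delta_r(\vec a)$, $\mathtt{body}^\Delta_r(\vec a)\,\text{:-}\,\mathtt{definitely\_q_1}(\vec a_1),\dots,\mathtt{definitely\_q_n}(\vec a_n)$; (iii) for each strict or defeasible rule $r:q_1(\vec a_1),\dots,q_n(\vec a_n)\hookrightarrow q(\vec a)$: $\mathtt{lambda\_q}(\vec a)\,\text{:-}\,not\ \mathtt{definitely\_{\sim}q}(\vec a),\mathtt{body}^\lambda_r(\vec a)$ and $\mathtt{defeasibly\_q}(\vec a)\,\text{:-}\,not\ \mathtt{definitely\_{\sim}q}(\vec a),\mathtt{body}^d_r(\vec a),not\ \mathtt{overruled\_q}(\vec a)$; (iv) for each rule $s$ of any kind, $s:q_1(\vec a_1),\dots,q_n(\vec a_n)\hookrightarrow q(\vec a)$: $\mathtt{body}^\lambda_s(\vec a)\,\text{:-}\,\mathtt{lambda\_q_1}(\vec a_1),\dots,\mathtt{lambda\_q_n}(\vec a_n)$, $\mathtt{body}^d_s(\vec a)\,\text{:-}\,\mathtt{defeasibly\_q_1}(\vec a_1),\dots,\mathtt{defeasibly\_q_n}(\vec a_n)$, $\mathtt{overruled\_{\sim}q}(\vec a)\,\text{:-}\,\mathtt{body}^\lambda_s(\vec a),not\ \mathtt{defeated\_q}(s,\vec a)$;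 (v) for each strict or defeasible rule $t$ with consequent $q(\vec a)$ and each rule $s$ with consequent of the form ${\sim}q(\dots)$ with $t>s$: $\mathtt{defeated\_{\sim}q}(s,\vec a)\,\text{:-}\,\mathtt{body}^d_t(\vec a)$. Dependencies. For predicates of a program, $p\sqsupseteq_{+1}q$ ($p\sqsupseteq_{-1}q$) if some clause has head predicate $p$ and a positive (negative) body literal with predicate $q$; $p\sqsupseteq q$ if either holds; $\geq$ is the transitive closure of $\sqsupseteq$ ($p$ depends on $q$ if $p\geq q$), and $q\leq p$ means $p\geq q$. $\geq_{+1},\geq_{-1}$ are the least relations with $p\geq_{+1}p$ and ($p\sqsupseteq_i q$, $q\geq_j r$ imply $p\geq_{i\cdot j}r$); $q\leq_i p$ means $p\geq_i q$. A set $\mathcal P$ of predicates is downward-closed if $p\in\mathcal P$ and $q\leq p$ imply $q\in\mathcal P$; it is downward-closed with floor $\mathcal F$ if $\mathcal F\subset\mathcal P$ and both are downward-closed. A signing for a set $\mathcal Q$ is a function $s$ from predicates to $\{-1,+1\}$ such that for $p,q\in\mathcal Q$, $p\leq_i q$ implies $s(p)=s(q)\cdot i$. An infinite sequence of atoms $q_1(\vec a_1),q_2(\vec a_2),\dots$ is unfounded with respect to $\mathcal Q$ if $q_i\sqsupseteq_{+1}q_{i+1}$ and $q_i\in\mathcal Q$ for all $i$. A predicate $p$ avoids negative unfoundedness with respect to a signing $s$ on $\mathcal Q$ if for every predicate $q$ with $s(q)=-1$ on which $p$ depends, no $q$-atom starts a sequence that is unfounded with respect to $\mathcal Q$. *)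

theory Defs
  imports Main
begin

type_synonym name = string

datatype trm = Var name | Fun name "trm list"

text \<open>Constants, including rule labels used as constants, are nullary applications.\<close>

abbreviation Const :: "name \<Rightarrow> trm" where
  "Const c \<equiv> Fun c []"

fun trm_vars :: "trm \<Rightarrow> name set" where
  "trm_vars (Var x) = {x}"
| "trm_vars (Fun f ts) = (\<Union>t\<in>set ts. trm_vars t)"

datatype atom = Atom (pred: name) (args: "trm list")

text \<open>\<open>Neg\<close> is classical negation, not negation as failure.\<close>

datatype lit = is_Pos: Pos (atom_of: atom) | Neg (atom_of: atom)

abbreviation lit_pred :: "lit \<Rightarrow> name" where
  "lit_pred q \<equiv> pred (atom_of q)"

abbreviation lit_args :: "lit \<Rightarrow> trm list" where
  "lit_args q \<equiv> args (atom_of q)"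

fun compl :: "lit \<Rightarrow> lit" where
  "compl (Pos a) = Neg a"
| "compl (Neg a) = Pos a"

definition ground :: "lit \<Rightarrow> bool" where
  "ground q \<longleftrightarrow> (\<forall>t\<in>set (lit_args q). trm_vars t = {})"

datatype kind = Strict | Defeasible | Defeater

record rule =
  label :: name
  kind :: kind
  antecedent :: "lit set"
  consequent :: lit

text \<open>A pair \<open>(t, s)\<close> in \<open>superiority\<close> means that \<open>t\<close> is superior to \<open>s\<close>.\<close>

record dtheory =
  facts :: "lit set"
  rules :: "rule set"
  superiority :: "(name \<times> name) set"

definition defeasible_theory :: "dtheory \<Rightarrow> bool" where
  "defeasible_theory D \<longleftrightarrow>
     finite (facts D) \<and> (\<forall>q\<in>facts D. ground q) \<and>
     finite (rules D) \<and> (\<forall>r\<in>rules D. finite (antecedent r)) \<and>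
     acyclic (superiority D)"

definition theory_lits :: "dtheory \<Rightarrow> lit set" where
  "theory_lits D =
     facts D \<union> (\<Union>r\<in>rules D. insert (consequent r) (antecedent r))"

definition theory_preds :: "dtheory \<Rightarrow> name set" where
  "theory_preds D = lit_pred ` theory_lits D"

text \<open>\<open>Naf\<close> is negation as failure.\<close>

datatype body_lit = Call atom | Naf atom

datatype clause = Clause (head: atom) (body: "body_lit set")

type_synonym program = "clause set"

fun body_lit_pred :: "body_lit \<Rightarrow> name" where
  "body_lit_pred (Call a) = pred a"
| "body_lit_pred (Naf a) = pred a"

fun body_lit_sign :: "body_lit \<Rightarrow> int" where
  "body_lit_sign (Call a) = 1"
| "body_lit_sign (Naf a) = - 1"

definition program_preds :: "program \<Rightarrow> name set" where
  "program_preds \<Pi> = (\<Union>c\<in>\<Pi>. insert (pred (head c)) (body_lit_pred ` body c))"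

text \<open>
  In the relations below the depending predicate comes first:
  \<open>direct_dep \<Pi> i p q\<close> is \<open>p \<sqsupseteq>\<^sub>i q\<close>, \<open>depends \<Pi> p q\<close> is \<open>p \<ge> q\<close> (transitive, not
  necessarily reflexive), and \<open>signed_dep \<Pi> i p q\<close> is \<open>p \<ge>\<^sub>i q\<close>, i.e. \<open>q \<le>\<^sub>i p\<close>.
\<close>

definition direct_dep :: "program \<Rightarrow> int \<Rightarrow> name \<Rightarrow> name \<Rightarrow> bool" where
  "direct_dep \<Pi> i p q \<longleftrightarrow>
     (\<exists>c\<in>\<Pi>. pred (head c) = p \<and>
        (\<exists>b\<in>body c. body_lit_pred b = q \<and> body_lit_sign b = i))"

definition depends :: "program \<Rightarrow> name \<Rightarrow> name \<Rightarrow> bool" where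
  "depends \<Pi> = (\<lambda>p q. direct_dep \<Pi> 1 p q \<or> direct_dep \<Pi> (- 1) p q)\<^sup>+\<^sup>+"

inductive signed_dep :: "program \<Rightarrow> int \<Rightarrow> name \<Rightarrow> name \<Rightarrow> bool" for \<Pi> where
  refl: "signed_dep \<Pi> 1 p p"
| step: "direct_dep \<Pi> i p q \<Longrightarrow> signed_dep \<Pi> j q r \<Longrightarrow> signed_dep \<Pi> (i * j) p r"

definition downward_closed :: "program \<Rightarrow> name set \<Rightarrow> bool" where
  "downward_closed \<Pi> P \<longleftrightarrow> (\<forall>p q. p \<in> P \<longrightarrow> depends \<Pi> p q \<longrightarrow> q \<in> P)"

text \<open>
  The inclusion is not required to be strict: for the empty theory both sets are empty.
\<close>

definition downward_closed_with_floor :: "program \<Rightarrow> name set \<Rightarrow> name set \<Rightarrow> bool" where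
  "downward_closed_with_floor \<Pi> P F \<longleftrightarrow>
     F \<subseteq> P \<and> downward_closed \<Pi> P \<and> downward_closed \<Pi> F"

definition signing :: "program \<Rightarrow> name set \<Rightarrow> (name \<Rightarrow> int) \<Rightarrow> bool" where
  "signing \<Pi> Q s \<longleftrightarrow>
     (\<forall>p. s p \<in> {- 1, 1}) \<and>
     (\<forall>p\<in>Q. \<forall>q\<in>Q. \<forall>i. signed_dep \<Pi> i q p \<longrightarrow> s p = s q * i)"

definition unfounded :: "program \<Rightarrow> name set \<Rightarrow> (nat \<Rightarrow> atom) \<Rightarrow> bool" where
  "unfounded \<Pi> Q \<sigma> \<longleftrightarrow>
     (\<forall>i. direct_dep \<Pi> 1 (pred (\<sigma> i)) (pred (\<sigma> (Suc i))) \<and> pred (\<sigma> i) \<in> Q)"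

definition avoids_negative_unfoundedness ::
    "program \<Rightarrow> name set \<Rightarrow> (name \<Rightarrow> int) \<Rightarrow> name \<Rightarrow> bool" where
  "avoids_negative_unfoundedness \<Pi> Q s p \<longleftrightarrow>
     (\<forall>q. s q = - 1 \<longrightarrow> depends \<Pi> p q \<longrightarrow>
        \<not> (\<exists>\<sigma>. pred (\<sigma> 0) = q \<and> unfounded \<Pi> Q \<sigma>))"

text \<open>
  Names are literal concatenations, hence not injective in the literal: a predicate
  \<open>not_p\<close> of the theory shares its names with the negative literals over \<open>p\<close>.
  The eight prefixes are pairwise incomparable, so names of different forms never coincide.
\<close>

fun lit_name :: "lit \<Rightarrow> name" where
  "lit_name (Pos a) = pred a"
| "lit_name (Neg a) = ''not_'' @ pred a"

definition definitely_name :: "lit \<Rightarrow> name" where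
  "definitely_name q = ''definitely_'' @ lit_name q"

definition lambda_name :: "lit \<Rightarrow> name" where
  "lambda_name q = ''lambda_'' @ lit_name q"

definition defeasibly_name :: "lit \<Rightarrow> name" where
  "defeasibly_name q = ''defeasibly_'' @ lit_name q"

definition overruled_name :: "lit \<Rightarrow> name" where
  "overruled_name q = ''overruled_'' @ lit_name q"

definition defeated_name :: "lit \<Rightarrow> name" where
  "defeated_name q = ''defeated_'' @ lit_name q"

definition body_Delta_name :: "name \<Rightarrow> name" where
  "body_Delta_name l = ''body_Delta_'' @ l"

definition body_lambda_name :: "name \<Rightarrow> name" where
  "body_lambda_name l = ''body_lambda_'' @ l"

definition body_d_name :: "name \<Rightarrow> name" where
  "body_d_name l = ''body_d_'' @ l"

abbreviation definitely :: "lit \<Rightarrow> atom" where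
  "definitely q \<equiv> Atom (definitely_name q) (lit_args q)"

abbreviation lambda :: "lit \<Rightarrow> atom" where
  "lambda q \<equiv> Atom (lambda_name q) (lit_args q)"

abbreviation defeasibly :: "lit \<Rightarrow> atom" where
  "defeasibly q \<equiv> Atom (defeasibly_name q) (lit_args q)"

abbreviation overruled :: "lit \<Rightarrow> atom" where
  "overruled q \<equiv> Atom (overruled_name q) (lit_args q)"

abbreviation defeated :: "lit \<Rightarrow> rule \<Rightarrow> atom" where
  "defeated q s \<equiv> Atom (defeated_name q) (Const (label s) # lit_args q)"

abbreviation body_Delta :: "rule \<Rightarrow> atom" where
  "body_Delta r \<equiv> Atom (body_Delta_name (label r)) (lit_args (consequent r))"

abbreviation body_lambda :: "rule \<Rightarrow> atom" where
  "body_lambda r \<equiv> Atom (body_lambda_name (label r)) (lit_args (consequent r))"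

abbreviation body_d :: "rule \<Rightarrow> atom" where
  "body_d r \<equiv> Atom (body_d_name (label r)) (lit_args (consequent r))"

definition fact_clauses :: "lit \<Rightarrow> program" where
  "fact_clauses q =
     {Clause (definitely q) {}, Clause (lambda q) {}, Clause (defeasibly q) {}}"

definition strict_clauses :: "rule \<Rightarrow> program" where
  "strict_clauses r =
     (let q = consequent r in
      {Clause (definitely q) {Call (body_Delta r)},
       Clause (lambda q) {Call (body_Delta r)},
       Clause (defeasibly q) {Call (body_Delta r)},
       Clause (body_Delta r) ((\<lambda>q'. Call (definitely q')) ` antecedent r)})"

definition supportive_clauses :: "rule \<Rightarrow> program" where
  "supportive_clauses r =
     (let q = consequent r in
      {Clause (lambda q) {Naf (definitely (compl q)), Call (body_lambda r)},
       Clause (defeasibly q)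
         {Naf (definitely (compl q)), Call (body_d r), Naf (overruled q)}})"

definition rule_clauses :: "rule \<Rightarrow> program" where
  "rule_clauses s =
     (let q = consequent s in
      {Clause (body_lambda s) ((\<lambda>q'. Call (lambda q')) ` antecedent s),
       Clause (body_d s) ((\<lambda>q'. Call (defeasibly q')) ` antecedent s),
       Clause (overruled (compl q)) {Call (body_lambda s), Naf (defeated q s)}})"

text \<open>
  Same predicate and opposite signs, but possibly different arguments. The arguments in the
  head of \<open>superiority_clause\<close> are those of the consequent of \<open>t\<close>.
\<close>

definition conflicting :: "lit \<Rightarrow> lit \<Rightarrow> bool" where
  "conflicting q q' \<longleftrightarrow> lit_pred q = lit_pred q' \<and> is_Pos q \<noteq> is_Pos q'"

definition superiority_clause :: "rule \<Rightarrow> rule \<Rightarrow> clause" where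
  "superiority_clause t s =
     Clause (defeated (compl (consequent t)) s) {Call (body_d t)}"

definition compiled_program :: "dtheory \<Rightarrow> program" where
  "compiled_program D =
     (\<Union>q\<in>facts D. fact_clauses q) \<union>
     (\<Union>r\<in>{r \<in> rules D. kind r = Strict}. strict_clauses r) \<union>
     (\<Union>r\<in>{r \<in> rules D. kind r \<in> {Strict, Defeasible}}. supportive_clauses r) \<union>
     (\<Union>s\<in>rules D. rule_clauses s) \<union>
     {superiority_clause t s | t s.
        t \<in> rules D \<and> kind t \<in> {Strict, Defeasible} \<and> s \<in> rules D \<and>
        conflicting (consequent t) (consequent s) \<and>
        (label t, label s) \<in> superiority D}"

end

(* Outside the floor, every clause of the compiled program respects the signing that is -1 exactly
   on the overruled predicates: these are linked negatively to defeasibly above and to defeated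
   below, and all other dependencies among defeasibly, body_d and defeated are positive. The only
   positive dependency of an overruled predicate is on a body_lambda predicate, which lies in the
   floor, so no unfounded sequence starts at an overruled predicate. *)
theory Submission
  imports Defs
begin

text \<open>Depends on the shape of the name alone, not on the program, so that simplification can
  decide it clause by clause.\<close>

definition floor_name :: "name \<Rightarrow> bool" where
  "floor_name p \<longleftrightarrow> (\<exists>q. p = definitely_name q) \<or> (\<exists>l. p = body_Delta_name l) \<or>
     (\<exists>q. p = lambda_name q) \<or> (\<exists>l. p = body_lambda_name l)"

definition overruled_sign :: "name \<Rightarrow> int" where
  "overruled_sign p = (if \<exists>q. p = overruled_name q then - 1 else 1)"

lemmas predicate_name_defs =
  definitely_name_def lambda_name_def defeasibly_name_def overruled_name_def
  defeated_name_def body_Delta_name_def body_lambda_name_def body_d_name_def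

lemma floor_name_simps [simp]:
  "floor_name (definitely_name q)" "floor_name (lambda_name q)"
  "floor_name (body_Delta_name l)" "floor_name (body_lambda_name l)"
  "\<not> floor_name (defeasibly_name q)" "\<not> floor_name (overruled_name q)"
  "\<not> floor_name (defeated_name q)" "\<not> floor_name (body_d_name l)"
  unfolding floor_name_def by (auto simp: predicate_name_defs)

lemma overruled_sign_simps [simp]:
  "overruled_sign (overruled_name q) = - 1" "overruled_sign (defeasibly_name q) = 1"
  "overruled_sign (defeated_name q) = 1" "overruled_sign (body_d_name l) = 1"
  unfolding overruled_sign_def by (auto simp: predicate_name_defs)

text \<open>Checked clause by clause. Read contrapositively, the first conjunct closes the floor
  downwards; the second is one step of the signing; the third will rule out unfounded
  sequences.\<close>

lemma direct_dep_compiled_program: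
  assumes "direct_dep (compiled_program D) i p q" "\<not> floor_name q"
  shows "\<not> floor_name p \<and> overruled_sign q = overruled_sign p * i \<and>
    (overruled_sign p = - 1 \<longrightarrow> i = - 1)"
  using assms
  unfolding direct_dep_def compiled_program_def
  by (auto simp: fact_clauses_def strict_clauses_def supportive_clauses_def rule_clauses_def
      superiority_clause_def Let_def)

text \<open>Being outside the floor passes upwards from \<open>q\<close> along the whole path, so
  the one-step sign rule applies at each edge and the signs multiply.\<close>

lemma signed_dep_compiled_program:
  assumes "signed_dep (compiled_program D) i p q" "\<not> floor_name q"
  shows "\<not> floor_name p \<and> overruled_sign q = overruled_sign p * i"
  using assms
proof induction
  case (step i p q j r)
  then show ?case
    using direct_dep_compiled_program[OF step.hyps(1)] by (simp add: mult.assoc)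
qed simp

lemma depends_compiled_program_floor:
  assumes "depends (compiled_program D) p q" "floor_name p"
  shows "floor_name q"
  using assms unfolding depends_def
  by induction (use direct_dep_compiled_program in blast)+

lemma direct_dep_program_preds: "direct_dep \<Pi> i p q \<Longrightarrow> q \<in> program_preds \<Pi>"
  unfolding direct_dep_def program_preds_def by blast

lemma depends_program_preds: "depends \<Pi> p q \<Longrightarrow> q \<in> program_preds \<Pi>"
  unfolding depends_def by (erule tranclp.cases) (auto dest: direct_dep_program_preds)

theorem theorem9:
  fixes D :: dtheory and S\<^sub>D :: program and P F Q :: "name set"
  assumes "defeasible_theory D"
    and "S\<^sub>D = compiled_program D"
    and "P = program_preds S\<^sub>D"
    and "F = {p \<in> P. (\<exists>q. p = definitely_name q) \<or> (\<exists>r. p = body_Delta_name r) \<or>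
                     (\<exists>q. p = lambda_name q) \<or> (\<exists>r. p = body_lambda_name r)}"
    and "Q = P - F"
  shows "downward_closed_with_floor S\<^sub>D P F \<and>
    (\<exists>s. signing S\<^sub>D Q s \<and> (\<forall>q. s (defeasibly_name q) = 1) \<and>
         (\<forall>q. lit_pred q \<in> theory_preds D \<longrightarrow>
              avoids_negative_unfoundedness S\<^sub>D Q s (defeasibly_name q)))"
proof -
  have F: "F = {p \<in> P. floor_name p}"
    using assms(4) by (simp add: floor_name_def)
  have Q: "\<not> floor_name p" if "p \<in> Q" for p
    using that F assms(5) by blast
  have "downward_closed_with_floor S\<^sub>D P F"
    unfolding downward_closed_with_floor_def downward_closed_def F assms(2,3)
    using depends_program_preds depends_compiled_program_floor by blast
  moreover have "signing S\<^sub>D Q overruled_sign"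
    unfolding signing_def
    using signed_dep_compiled_program Q assms(2) by (auto simp: overruled_sign_def)
  moreover have "avoids_negative_unfoundedness S\<^sub>D Q overruled_sign p" for p
    unfolding avoids_negative_unfoundedness_def
  proof (intro allI impI notI, elim exE conjE)
    fix q \<sigma>
    assume q: "overruled_sign q = - 1" and \<sigma>: "pred (\<sigma> 0) = q" "unfounded S\<^sub>D Q \<sigma>"
    \<comment> \<open>Two terms of the sequence suffice: the second must also lie in
      \<open>Q\<close>, hence outside the floor, where a predicate of sign -1 has only negative
      direct dependencies.\<close>
    have "direct_dep S\<^sub>D 1 q (pred (\<sigma> (Suc 0)))" "pred (\<sigma> (Suc 0)) \<in> Q"
      using \<sigma> unfolding unfounded_def by auto
    then show False
      using direct_dep_compiled_program[of D 1] q Q assms(2) by fastforce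
  qed
  ultimately show ?thesis
    by (intro conjI exI[of _ overruled_sign]) auto
qed

end
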